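(* Take one of the ten records listed in the context, or its simultaneous reflection, and require: 1. the coefficient $m$ is greater than two; 2. its ordered arguments give a symmetrizable Nahm system with denominator steps $(1,m)$ and positive cross term; 3. the quadratic matrix $AD$ is positive definite; 4. its quadratic exponent $\tfrac12(r,s)AD(r,s)^T$ can be made integer-valued on $\mathbb Z^2$ by adding a rational linear term in $(r,s)$ (without restricting the summation lattice or replacing $q$ by a power of it). Then the only quadratic forms obtained are the following three: $$\begin{array}{c|c|c|c} m&A&\tfrac12(r,s)AD(r,s)^T&6\Lambda/\pi^2\\\hline 3&\begin{pmatrix}2&1\\3&2\end{pmatrix}&r^2+3rs+3s^2&4/9\\ 13&\begin{pmatrix}4&1\\13&4\end{pmatrix}&2r^2+13rs+26s^2&4/13\\ 31&\begin{pmatrix}6&1\\31&6\end{pmatrix}&3r^2+31rs+93s^2&8/31 \end{array}$$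
   Context: A record consists of an ordered pair of real numbers $(x,y)$ with $0<x,y<1$, an integer $m>1$, a rational $c_0$ and integers $p,h,u,v$ such that $x$ and $1-x$ are multiplicatively independent, $$y=x^p(1-x)^h,\qquad 1-y=x^u(1-x)^v,\qquad pv-hu=-m,$$ and $mL(x)+L(y)=c_0\pi^2$, where $L(t)=\operatorname{Li}_2(t)+\tfrac12\log t\log(1-t)$ for $0<t<1$ and $L(1)=\pi^2/6$ (Rogers dilogarithm). The ten records (the ten normalized two-term Rogers identities from the simplest cubic fields; $N$ is the conductor of the cubic field of the arguments) have the following data $(N;m;c_0;p,h,u,v)$: Row 1: $(7;2;2/7;-2,2,-1,2)$. Row 2: $(7;2;5/21;2,0,2,-1)$. Row 3: $(9;3;4/9;-2,1,-1,2)$. Row 4: $(7;7;2/3;-2,3,1,2)$. Row 5: $(13;13;5/3;-4,1,-3,4)$. Row 6: $(9;19;4/3;-2,5,3,2)$. Row 7: $(7;13;4/3;-4,3,-1,4)$. Row 8: $(19;31;4;-6,1,-5,6)$. Row 9: $(7;2;13/42;-1,1,0,2)$. Row 10: $(7;97;15/2;-8,11,3,8)$. The simultaneous reflection of a record replaces the ordered arguments $(x,y)$ by $(1-x,1-y)$ and the exponents $(p,h,u,v)$ by $(v,u,h,p)$, with the same $m$. Ordered arguments $(z_0,z_1)\in(0,1)^2$ give a symmetrizable Nahm system with denominator steps $(1,m)$ if there is a rational $2\times2$ matrix $A$ (rows and columns indexed by $0,1$) with $1-z_i=\prod_j z_j^{A_{ij}}$ for $i=0,1$ (positive real powers) such that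 $AD$ is symmetric, where $D=\operatorname{diag}(1,m)$. The quadratic matrix is $AD$, the cross term is its off-diagonal entry, and the quadratic exponent is $\tfrac12(r,s)AD(r,s)^T$. The radial action is $\Lambda=(L(1)-L(z_0))+\tfrac1m(L(1)-L(z_1))$. *)

theory Defs
  imports "HOL-Analysis.Analysis"
begin

definition Li2 :: "real \<Rightarrow> real" where
  "Li2 t = (\<Sum>n. t ^ Suc n / real (Suc n) ^ 2)"

(* Rogers dilogarithm, used for 0 < t \<le> 1 only. *)
definition rogers_L :: "real \<Rightarrow> real" where
  "rogers_L t = (if t = 1 then pi^2 / 6 else Li2 t + 1/2 * ln t * ln (1 - t))"

definition mult_independent :: "real \<Rightarrow> real \<Rightarrow> bool" where
  "mult_independent a b \<longleftrightarrow>
     (\<forall>i j :: int. a powi i * b powi j = 1 \<longrightarrow> i = 0 \<and> j = 0)"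

record rogers_record =
  arg_x :: real
  arg_y :: real
  coef_m :: int
  const_c0 :: rat
  exp_p :: int
  exp_h :: int
  exp_u :: int
  exp_v :: int

definition is_record :: "rogers_record \<Rightarrow> bool" where
  "is_record R \<longleftrightarrow>
     (let x = arg_x R; y = arg_y R; m = coef_m R;
          p = exp_p R; h = exp_h R; u = exp_u R; v = exp_v R
      in 0 < x \<and> x < 1 \<and> 0 < y \<and> y < 1 \<and> m > 1 \<and>
         mult_independent x (1 - x) \<and>
         y = x powi p * (1 - x) powi h \<and>
         1 - y = x powi u * (1 - x) powi v \<and>
         p * v - h * u = - m \<and>
         of_int m * rogers_L x + rogers_L y = of_rat (const_c0 R) * pi^2)"

definition record_data :: "rogers_record \<Rightarrow> int \<times> rat \<times> int \<times> int \<times> int \<times> int" where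
  "record_data R = (coef_m R, const_c0 R, exp_p R, exp_h R, exp_u R, exp_v R)"

(* Entries (m, c0, p, h, u, v).  In order, the conductors of the cubic fields of the arguments
   are 7, 7, 9, 7, 13, 9, 7, 19, 7, 7. *)
definition ten_record_data :: "(int \<times> rat \<times> int \<times> int \<times> int \<times> int) list" where
  "ten_record_data =
    [(2, 2/7, -2, 2, -1, 2),
     (2, 5/21, 2, 0, 2, -1),
     (3, 4/9, -2, 1, -1, 2),
     (7, 2/3, -2, 3, 1, 2),
     (13, 5/3, -4, 1, -3, 4),
     (19, 4/3, -2, 5, 3, 2),
     (13, 4/3, -4, 3, -1, 4),
     (31, 4, -6, 1, -5, 6),
     (2, 13/42, -1, 1, 0, 2),
     (97, 15/2, -8, 11, 3, 8)]"

(* The new constant is the one forced by L(t) + L(1 - t) = pi^2 / 6, which makes the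
   reflection a record again. *)
definition reflect :: "rogers_record \<Rightarrow> rogers_record" where
  "reflect R = \<lparr> arg_x = 1 - arg_x R, arg_y = 1 - arg_y R, coef_m = coef_m R,
                 const_c0 = (of_int (coef_m R) + 1) / 6 - const_c0 R,
                 exp_p = exp_v R, exp_h = exp_u R, exp_u = exp_h R, exp_v = exp_p R \<rparr>"

(* The mathematical indices 0, 1 of pairs and of 2 x 2 matrices are the library indices 1, 2
   of the index type 2.  A rational vector or matrix is a real one with rational entries. *)

definition ordered_args :: "rogers_record \<Rightarrow> real^2" where
  "ordered_args R = vector [arg_x R, arg_y R]"

definition step_matrix :: "int \<Rightarrow> real^2^2" where
  "step_matrix m = vector [vector [1, 0], vector [0, of_int m]]"

definition quadratic_matrix :: "int \<Rightarrow> real^2^2 \<Rightarrow> real^2^2" where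
  "quadratic_matrix m A = A ** step_matrix m"

definition symmetrizable_nahm :: "real^2 \<Rightarrow> int \<Rightarrow> real^2^2 \<Rightarrow> bool" where
  "symmetrizable_nahm z m A \<longleftrightarrow>
     (\<forall>i. 0 < z $ i \<and> z $ i < 1) \<and>
     (\<forall>i j. A $ i $ j \<in> \<rat>) \<and>
     (\<forall>i. 1 - z $ i = (\<Prod>j\<in>UNIV. (z $ j) powr (A $ i $ j))) \<and>
     transpose (quadratic_matrix m A) = quadratic_matrix m A"

definition cross_term :: "real^2^2 \<Rightarrow> real" where
  "cross_term M = M $ 1 $ 2"

definition positive_definite :: "real^'n^'n \<Rightarrow> bool" where
  "positive_definite M \<longleftrightarrow> transpose M = M \<and> (\<forall>w. w \<noteq> 0 \<longrightarrow> w \<bullet> (M *v w) > 0)"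

definition quadratic_exponent :: "real^2^2 \<Rightarrow> real \<Rightarrow> real \<Rightarrow> real" where
  "quadratic_exponent M r s = 1/2 * (vector [r, s] \<bullet> (M *v vector [r, s]))"

definition integral_up_to_linear :: "(real \<Rightarrow> real \<Rightarrow> real) \<Rightarrow> bool" where
  "integral_up_to_linear Q \<longleftrightarrow>
     (\<exists>a\<in>\<rat>. \<exists>b\<in>\<rat>. \<forall>r s :: int.
        Q (of_int r) (of_int s) + (a * of_int r + b * of_int s) \<in> \<int>)"

definition radial_action :: "real^2 \<Rightarrow> int \<Rightarrow> real" where
  "radial_action z m =
     (rogers_L 1 - rogers_L (z $ 1)) + 1 / of_int m * (rogers_L 1 - rogers_L (z $ 2))"

end

theory Submission
  imports Defs
begin

text \<open>
  Taking logarithms turns the exponent relations of a record into two linear relations over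
  \<open>ln x\<close> and \<open>ln (1 - x)\<close>, and multiplicative independence makes these two numbers linearly
  independent over the rationals. Comparing coefficients in the Nahm equations therefore leaves
  at most one rational matrix, namely
  \<open>A = (-p/h, 1/h; m/h, v/h)\<close>, and none when \<open>h = 0\<close>; the determinant relation
  \<open>p v - h u = - m\<close> makes \<open>A D = (-p/h, m/h; m/h, m v/h)\<close> symmetric of determinant
  \<open>- m u / h\<close> (lemma \<open>symmetrizable_nahm_iff\<close>).

  The remaining requirements become conditions on the exponents alone. The cross term is
  positive iff \<open>h > 0\<close>; then positive definiteness says \<open>p < 0\<close> and \<open>u < 0\<close>. A quadratic
  exponent is integral up to a linear term iff all the entries of its matrix are integers, as
  second differences show, and by the determinant relation this comes down to \<open>h dvd p\<close>
  (lemma \<open>nahm_selection_iff\<close>). The exponent relations are stable under reflection, so the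
  same criterion applies to the twenty quadruples of exponents, of which it keeps three.
  The dilogarithm identity gives the radial action of these three, which is affine in
  \<open>m L(x) + L(y)\<close>.
\<close>

section \<open>Two by two matrices\<close>

lemma matrix2_eq_iff:
  "M = vector [vector [a, b], vector [c, d]] \<longleftrightarrow>
     M $ 1 $ 1 = a \<and> M $ 1 $ 2 = b \<and> M $ 2 $ 1 = c \<and> M $ 2 $ 2 = d"
  for M :: "real^2^2"
  by (auto simp: vec_eq_iff forall_2)

lemma quadratic_matrix_eq:
  "quadratic_matrix m A =
     vector [vector [A $ 1 $ 1, of_int m * A $ 1 $ 2], vector [A $ 2 $ 1, of_int m * A $ 2 $ 2]]"
  by (simp add: quadratic_matrix_def step_matrix_def matrix_matrix_mult_def matrix2_eq_iff sum_2)

lemma inner_matrix_vector2: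
  "w \<bullet> (M *v w) =
     M $ 1 $ 1 * (w $ 1)^2 + (M $ 1 $ 2 + M $ 2 $ 1) * w $ 1 * w $ 2 + M $ 2 $ 2 * (w $ 2)^2"
  for M :: "real^2^2"
  by (simp add: inner_vec_def matrix_vector_mult_def sum_2 algebra_simps power2_eq_square)

lemma quadratic_exponent_eq:
  assumes "M $ 2 $ 1 = M $ 1 $ 2"
  shows "quadratic_exponent M r s =
           M $ 1 $ 1 / 2 * r^2 + M $ 1 $ 2 * r * s + M $ 2 $ 2 / 2 * s^2"
  using assms by (simp add: quadratic_exponent_def inner_matrix_vector2 field_simps)

lemma transpose_matrix2_iff: "transpose M = M \<longleftrightarrow> M $ 2 $ 1 = M $ 1 $ 2"
  for M :: "real^2^2"
  by (auto simp: transpose_def vec_eq_iff forall_2)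

text \<open>
  Sylvester's criterion in rank two: one completes the square, and the test vectors
  \<open>(1, 0)\<close> and \<open>(- b, a)\<close> for \<open>M = (a, b; b, d)\<close> show that both minors have to be positive.
\<close>

lemma positive_definite_matrix2_iff:
  fixes M :: "real^2^2"
  assumes sym: "M $ 2 $ 1 = M $ 1 $ 2"
  shows "positive_definite M \<longleftrightarrow>
           0 < M $ 1 $ 1 \<and> 0 < M $ 1 $ 1 * M $ 2 $ 2 - (M $ 1 $ 2)^2"
proof -
  define a b d where abd: "a = M $ 1 $ 1" "b = M $ 1 $ 2" "d = M $ 2 $ 2"
  have form: "w \<bullet> (M *v w) = a * (w $ 1)^2 + 2 * b * w $ 1 * w $ 2 + d * (w $ 2)^2" for w
    by (simp add: inner_matrix_vector2 abd sym)
  have "(\<forall>w. w \<noteq> 0 \<longrightarrow> w \<bullet> (M *v w) > 0) \<longleftrightarrow> 0 < a \<and> 0 < a * d - b^2"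
  proof safe
    assume pos: "\<forall>w. w \<noteq> 0 \<longrightarrow> w \<bullet> (M *v w) > 0"
    have "vector [1, 0] \<noteq> (0 :: real^2)"
      by (simp add: vec_eq_iff forall_2)
    with pos have "vector [1, 0] \<bullet> (M *v vector [1, 0]) > 0"
      by blast
    then show a: "0 < a"
      by (simp add: form)
    have "vector [- b, a] \<noteq> (0 :: real^2)"
      using a by (simp add: vec_eq_iff forall_2)
    with pos have "vector [- b, a] \<bullet> (M *v vector [- b, a]) > 0"
      by blast
    then have "a * (a * d - b^2) > 0"
      by (simp add: form algebra_simps power2_eq_square)
    with a show "0 < a * d - b^2"
      by (simp add: zero_less_mult_iff)
  next
    fix w :: "real^2"
    assume a: "0 < a" and det: "0 < a * d - b^2" and "w \<noteq> 0"
    then have w: "w $ 1 \<noteq> 0 \<or> w $ 2 \<noteq> 0"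
      by (simp add: vec_eq_iff forall_2)
    have square: "a * (w \<bullet> (M *v w)) = (a * w $ 1 + b * w $ 2)^2 + (a * d - b^2) * (w $ 2)^2"
      by (simp add: form algebra_simps power2_eq_square)
    have "0 < (a * w $ 1 + b * w $ 2)^2 + (a * d - b^2) * (w $ 2)^2"
    proof (cases "w $ 2 = 0")
      case True
      with w a show ?thesis by simp
    next
      case False
      with det show ?thesis by (intro add_nonneg_pos) auto
    qed
    with a square show "w \<bullet> (M *v w) > 0"
      by (metis zero_less_mult_pos)
  qed
  then show ?thesis
    by (simp add: positive_definite_def transpose_matrix2_iff sym abd)
qed

text \<open>
  A linear term does not affect second differences, and those of the quadratic exponent are
  the entries of \<open>M\<close>. Conversely the linear term with coefficients half the diagonal entries
  suffices, since \<open>r (r + 1)\<close> is even.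
\<close>

lemma integral_up_to_linear_iff:
  fixes M :: "real^2^2"
  assumes sym: "M $ 2 $ 1 = M $ 1 $ 2"
  shows "integral_up_to_linear (quadratic_exponent M) \<longleftrightarrow>
           M $ 1 $ 1 \<in> \<int> \<and> M $ 1 $ 2 \<in> \<int> \<and> M $ 2 $ 2 \<in> \<int>"
proof
  assume "integral_up_to_linear (quadratic_exponent M)"
  then obtain a b where ab: "\<And>r s :: int.
      quadratic_exponent M (of_int r) (of_int s) + (a * of_int r + b * of_int s) \<in> \<int>"
    unfolding integral_up_to_linear_def by blast
  define F where
    "F r s = quadratic_exponent M (of_int r) (of_int s) + (a * of_int r + b * of_int s)"
    for r s :: int
  have F: "F r s \<in> \<int>" for r s
    using ab by (simp add: F_def)
  have "M $ 1 $ 1 = F 1 0 + F (-1) 0 - 2 * F 0 0"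
       "M $ 2 $ 2 = F 0 1 + F 0 (-1) - 2 * F 0 0"
       "M $ 1 $ 2 = F 1 1 - F 1 0 - F 0 1 + F 0 0"
    by (simp_all add: F_def quadratic_exponent_eq[OF sym])
  then show "M $ 1 $ 1 \<in> \<int> \<and> M $ 1 $ 2 \<in> \<int> \<and> M $ 2 $ 2 \<in> \<int>"
    using F by (simp del: add_0 add_0_right)
next
  assume "M $ 1 $ 1 \<in> \<int> \<and> M $ 1 $ 2 \<in> \<int> \<and> M $ 2 $ 2 \<in> \<int>"
  then obtain a b d :: int where
    abd: "M $ 1 $ 1 = of_int a" "M $ 1 $ 2 = of_int b" "M $ 2 $ 2 = of_int d"
    by (meson Ints_cases)
  have half: "of_int (r * (r + 1)) / 2 \<in> (\<int> :: real set)" for r :: int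
  proof -
    have "even (r * (r + 1))" by simp
    then obtain k where "r * (r + 1) = 2 * k" by (rule evenE)
    then show ?thesis by simp
  qed
  have "quadratic_exponent M (of_int r) (of_int s)
          + (of_int a / 2 * of_int r + of_int d / 2 * of_int s) \<in> \<int>" for r s :: int
  proof -
    have "quadratic_exponent M (of_int r) (of_int s)
            + (of_int a / 2 * of_int r + of_int d / 2 * of_int s)
          = of_int a * (of_int (r * (r + 1)) / 2) + of_int (b * r * s)
            + of_int d * (of_int (s * (s + 1)) / 2)"
      by (simp add: quadratic_exponent_eq[OF sym] abd field_simps power2_eq_square)
    then show ?thesis
      using half by (metis Ints_add Ints_mult Ints_of_int)
  qed
  then show "integral_up_to_linear (quadratic_exponent M)"
    unfolding integral_up_to_linear_def
    by (intro bexI[of _ "of_int a / 2"] bexI[of _ "of_int d / 2"]) auto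
qed

section \<open>The Nahm matrix of a record\<close>

lemma ln_power_int: "ln (x powi n) = of_int n * ln x" if "x > 0" for x :: real
  using that ln_powr[of x "of_int n"] by (simp add: powr_real_of_int')

text \<open>A common denominator turns rational coefficients into integer exponents.\<close>

lemma ln_rat_independent:
  assumes indep: "mult_independent a b" and pos: "0 < a" "0 < b"
    and rat: "s \<in> \<rat>" "t \<in> \<rat>" and rel: "s * ln a + t * ln b = 0"
  shows "s = 0 \<and> t = 0"
proof -
  obtain i k :: int where s: "k > 0" "s = of_int i / of_int k"
    using rat(1) by (auto elim: Rats_cases')
  obtain j l :: int where t: "l > 0" "t = of_int j / of_int l"
    using rat(2) by (auto elim: Rats_cases')
  have "ln (a powi (i * l) * b powi (j * k))
          = of_int k * of_int l * (s * ln a + t * ln b)"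
    using pos s(1) t(1) by (simp add: ln_mult ln_power_int s(2) t(2) algebra_simps)
  then have "ln (a powi (i * l) * b powi (j * k)) = 0"
    using rel by simp
  moreover have "0 < a powi (i * l) * b powi (j * k)"
    using pos by simp
  ultimately have "a powi (i * l) * b powi (j * k) = 1"
    by simp
  then have "i * l = 0 \<and> j * k = 0"
    using indep unfolding mult_independent_def by blast
  with s t show ?thesis by simp
qed

text \<open>
  The part of a record that does not involve the dilogarithm. It is visibly stable under
  reflection, whereas for the dilogarithm identity this requires Euler's reflection formula.
\<close>

definition exponent_relations :: "rogers_record \<Rightarrow> bool" where
  "exponent_relations R \<longleftrightarrow>
     0 < arg_x R \<and> arg_x R < 1 \<and> 0 < arg_y R \<and> arg_y R < 1 \<and> coef_m R > 1 \<and>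
     mult_independent (arg_x R) (1 - arg_x R) \<and>
     arg_y R = arg_x R powi exp_p R * (1 - arg_x R) powi exp_h R \<and>
     1 - arg_y R = arg_x R powi exp_u R * (1 - arg_x R) powi exp_v R \<and>
     exp_p R * exp_v R - exp_h R * exp_u R = - coef_m R"

lemma is_record_exponent_relations: "is_record R \<Longrightarrow> exponent_relations R"
  by (simp add: is_record_def exponent_relations_def Let_def)

lemma mult_independent_commute: "mult_independent a b \<longleftrightarrow> mult_independent b a"
  unfolding mult_independent_def by (metis mult.commute)

lemma exponent_relations_reflect:
  assumes "exponent_relations R"
  shows "exponent_relations (reflect R)"
  using assms mult_independent_commute[of "arg_x R" "1 - arg_x R"]
  by (simp add: exponent_relations_def reflect_def mult.commute)

definition nahm_matrix :: "rogers_record \<Rightarrow> real^2^2" where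
  "nahm_matrix R =
     vector [vector [- of_int (exp_p R) / of_int (exp_h R), 1 / of_int (exp_h R)],
             vector [of_int (coef_m R) / of_int (exp_h R),
                     of_int (exp_v R) / of_int (exp_h R)]]"

text \<open>
  In logarithms the Nahm equations are \<open>W = a X + b Y\<close> and \<open>u X + v W = c X + d Y\<close>, where
  \<open>X = ln x\<close>, \<open>W = ln (1 - x)\<close> and \<open>Y = p X + h W\<close>. Independence of \<open>X\<close> and \<open>W\<close> gives
  \<open>b h = 1\<close>, \<open>a + b p = 0\<close> and \<open>d h = v\<close>; in particular \<open>h\<close> is nonzero. Symmetry, which reads
  \<open>c = m b\<close>, fixes the last entry, and the determinant relation is what makes this agree with
  the remaining coefficient equation \<open>c + d p = u\<close>.
\<close>

lemma symmetrizable_nahm_iff: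
  assumes R: "exponent_relations R"
  shows "symmetrizable_nahm (ordered_args R) (coef_m R) A \<longleftrightarrow>
           exp_h R \<noteq> 0 \<and> A = nahm_matrix R"
proof -
  define x y m p h u v where defs: "x = arg_x R" "y = arg_y R" "m = coef_m R"
    "p = exp_p R" "h = exp_h R" "u = exp_u R" "v = exp_v R"
  have xy: "0 < x" "x < 1" "0 < y" "y < 1" and indep: "mult_independent x (1 - x)"
    and y: "y = x powi p * (1 - x) powi h" and y': "1 - y = x powi u * (1 - x) powi v"
    and det: "p * v - h * u = - m"
    using R by (simp_all add: exponent_relations_def defs)
  define X W where XW: "X = ln x" "W = ln (1 - x)"
  have ln_y: "ln y = of_int p * X + of_int h * W"
    unfolding y XW using xy by (simp add: ln_mult ln_power_int)
  have ln_y': "ln (1 - y) = of_int u * X + of_int v * W"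
    unfolding y' XW using xy by (simp add: ln_mult ln_power_int)
  \<comment> \<open>The equation \<open>1 - z = x\<^sup>\<alpha> y\<^sup>\<beta>\<close> is linear in logarithms, all the numbers being positive.\<close>
  have log_form: "1 - z = x powr \<alpha> * y powr \<beta> \<longleftrightarrow>
      ln (1 - z) = (\<alpha> + \<beta> * of_int p) * X + \<beta> * of_int h * W" if "z < 1" for z \<alpha> \<beta>
  proof -
    have "1 - z = x powr \<alpha> * y powr \<beta> \<longleftrightarrow> ln (1 - z) = ln (x powr \<alpha> * y powr \<beta>)"
      using that xy by (subst ln_inj_iff) auto
    also have "ln (x powr \<alpha> * y powr \<beta>) = \<alpha> * X + \<beta> * ln y"
      using xy by (simp add: ln_mult ln_powr XW)
    finally show ?thesis
      by (simp add: ln_y algebra_simps)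
  qed
  have XW_indep: "s = s' \<and> t = t'"
    if "s * X + t * W = s' * X + t' * W" "s \<in> \<rat>" "t \<in> \<rat>" "s' \<in> \<rat>" "t' \<in> \<rat>" for s t s' t'
  proof -
    have "(s - s') * X + (t - t') * W = 0"
      using that(1) by (simp add: algebra_simps)
    then show ?thesis
      using ln_rat_independent[OF indep, of "s - s'" "t - t'"] xy that by (simp add: XW)
  qed
  have nahm_unfold: "symmetrizable_nahm (ordered_args R) (coef_m R) A \<longleftrightarrow>
      (\<forall>i j. A $ i $ j \<in> \<rat>) \<and>
      W = (A $ 1 $ 1 + A $ 1 $ 2 * of_int p) * X + A $ 1 $ 2 * of_int h * W \<and>
      of_int u * X + of_int v * W
        = (A $ 2 $ 1 + A $ 2 $ 2 * of_int p) * X + A $ 2 $ 2 * of_int h * W \<and>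
      A $ 2 $ 1 = of_int m * A $ 1 $ 2"
    using xy log_form[of x "A $ 1 $ 1" "A $ 1 $ 2"] log_form[of y "A $ 2 $ 1" "A $ 2 $ 2"]
    by (simp add: symmetrizable_nahm_def ordered_args_def forall_2 UNIV_2
        transpose_matrix2_iff quadratic_matrix_eq flip: defs ln_y' XW)
  show ?thesis
  proof
    assume "symmetrizable_nahm (ordered_args R) (coef_m R) A"
    then have rat: "\<And>i j. A $ i $ j \<in> \<rat>"
      and row1: "0 * X + 1 * W = (A $ 1 $ 1 + A $ 1 $ 2 * of_int p) * X + A $ 1 $ 2 * of_int h * W"
      and row2: "of_int u * X + of_int v * W
        = (A $ 2 $ 1 + A $ 2 $ 2 * of_int p) * X + A $ 2 $ 2 * of_int h * W"
      and sym: "A $ 2 $ 1 = of_int m * A $ 1 $ 2"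
      unfolding nahm_unfold by simp_all
    have 1: "0 = A $ 1 $ 1 + A $ 1 $ 2 * of_int p" "1 = A $ 1 $ 2 * of_int h"
      using XW_indep[OF row1] rat by simp_all
    have 2: "of_int v = A $ 2 $ 2 * of_int h"
      using XW_indep[OF row2] rat by simp_all
    from 1 have h: "of_int h \<noteq> (0 :: real)" by auto
    have "A $ 1 $ 2 = 1 / of_int h" "A $ 2 $ 2 = of_int v / of_int h"
      using 1 2 h by (simp_all add: field_simps)
    moreover from this have "A $ 1 $ 1 = - of_int p / of_int h"
      using 1 by simp
    ultimately show "exp_h R \<noteq> 0 \<and> A = nahm_matrix R"
      using sym h by (simp add: nahm_matrix_def matrix2_eq_iff defs)
  next
    assume "exp_h R \<noteq> 0 \<and> A = nahm_matrix R"
    then have h: "of_int h \<noteq> (0 :: real)"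
      and A: "A $ 1 $ 1 = - of_int p / of_int h" "A $ 1 $ 2 = 1 / of_int h"
        "A $ 2 $ 1 = of_int m / of_int h" "A $ 2 $ 2 = of_int v / of_int h"
      by (simp_all add: nahm_matrix_def defs)
    have "of_int p * of_int v - of_int h * of_int u = (- of_int m :: real)"
      using det by (metis of_int_diff of_int_minus of_int_mult)
    then have "of_int m + of_int v * of_int p = (of_int u * of_int h :: real)"
      by (simp add: algebra_simps)
    then have u: "A $ 2 $ 1 + A $ 2 $ 2 * of_int p = of_int u"
      using h by (simp add: A add_divide_distrib[symmetric])
    show "symmetrizable_nahm (ordered_args R) (coef_m R) A"
      unfolding nahm_unfold u using h by (simp add: A forall_2)
  qed
qed

section \<open>The selection criterion\<close>

definition nahm_selection :: "rogers_record \<Rightarrow> real^2^2 \<Rightarrow> bool" where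
  "nahm_selection R A \<longleftrightarrow>
     coef_m R > 2 \<and>
     symmetrizable_nahm (ordered_args R) (coef_m R) A \<and>
     cross_term (quadratic_matrix (coef_m R) A) > 0 \<and>
     positive_definite (quadratic_matrix (coef_m R) A) \<and>
     integral_up_to_linear (quadratic_exponent (quadratic_matrix (coef_m R) A))"

text \<open>
  Since \<open>m = h u - p v\<close>, divisibility of \<open>p\<close> by \<open>h\<close> already makes \<open>m / h\<close> and \<open>m v / h\<close>
  integers.
\<close>

lemma nahm_selection_iff:
  assumes R: "exponent_relations R"
  shows "nahm_selection R A \<longleftrightarrow>
           coef_m R > 2 \<and> exp_h R > 0 \<and> exp_p R < 0 \<and> exp_u R < 0 \<and> exp_h R dvd exp_p R \<and>
           A = nahm_matrix R"
proof (cases "exp_h R > 0 \<and> A = nahm_matrix R")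
  case False
  have "exp_h R > 0 \<and> A = nahm_matrix R" if "nahm_selection R A"
  proof -
    from that have nahm: "exp_h R \<noteq> 0" "A = nahm_matrix R"
      and m: "coef_m R > 2" and cross: "cross_term (quadratic_matrix (coef_m R) A) > 0"
      by (auto simp: nahm_selection_def symmetrizable_nahm_iff[OF R])
    have "(of_int (coef_m R) :: real) / of_int (exp_h R) > 0"
      using cross nahm by (simp add: cross_term_def quadratic_matrix_eq nahm_matrix_def)
    with m nahm show ?thesis
      by (simp add: zero_less_divide_iff)
  qed
  with False show ?thesis by blast
next
  case True
  define m p h u v where defs: "m = coef_m R" "p = exp_p R" "h = exp_h R"
    "u = exp_u R" "v = exp_v R"
  define M where "M = quadratic_matrix m A"
  from True have h: "h > 0" and A: "A = nahm_matrix R"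
    by (simp_all add: defs)
  have m: "m > 1" and det: "m = h * u - p * v"
    using R by (simp_all add: exponent_relations_def defs)
  have M: "M $ 1 $ 1 = - of_int p / of_int h" "M $ 1 $ 2 = of_int m / of_int h"
    "M $ 2 $ 1 = of_int m / of_int h" "M $ 2 $ 2 = of_int m * of_int v / of_int h"
    by (simp_all add: M_def A quadratic_matrix_eq nahm_matrix_def defs)
  have sym: "M $ 2 $ 1 = M $ 1 $ 2" by (simp add: M)
  have "M $ 1 $ 1 * M $ 2 $ 2 - (M $ 1 $ 2)^2
          = of_int m * (- of_int p * of_int v - of_int m) / (of_int h)^2"
    using h by (simp add: M field_simps power2_eq_square)
  also have "- of_int p * of_int v - of_int m = (- of_int u * of_int h :: real)"
    by (simp add: det)
  also have "of_int m * (- of_int u * of_int h) / (of_int h)^2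
      = - (of_int m * of_int u / (of_int h :: real))"
    by (simp add: power2_eq_square)
  finally have "positive_definite M \<longleftrightarrow> p < 0 \<and> u < 0"
    using h m by (simp add: positive_definite_matrix2_iff[OF sym] M
        divide_less_0_iff mult_less_0_iff)
  moreover have "integral_up_to_linear (quadratic_exponent M) \<longleftrightarrow> h dvd p"
  proof
    assume "integral_up_to_linear (quadratic_exponent M)"
    then have "- of_int p / of_int h \<in> (\<int> :: real set)"
      by (simp add: integral_up_to_linear_iff[OF sym] M)
    then obtain k :: int where "- of_int p / of_int h = (of_int k :: real)"
      by (rule Ints_cases)
    then have "of_int p = (of_int (h * - k) :: real)"
      using h by (simp add: field_simps)
    then have "p = h * - k" by (simp only: of_int_eq_iff)
    then show "h dvd p" by (rule dvdI)
  next
    assume "h dvd p"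
    then obtain k where k: "p = h * k" by (rule dvdE)
    then have "m = h * (u - k * v)" by (simp add: det algebra_simps)
    then have "M $ 1 $ 1 = of_int (- k)" "M $ 1 $ 2 = of_int (u - k * v)"
      "M $ 2 $ 2 = of_int ((u - k * v) * v)"
      using h by (simp_all add: M k)
    then show "integral_up_to_linear (quadratic_exponent M)"
      unfolding integral_up_to_linear_iff[OF sym] by (metis Ints_of_int)
  qed
  moreover have "cross_term M > 0"
    using h m by (simp add: cross_term_def M)
  moreover have "symmetrizable_nahm (ordered_args R) m A"
    using h A symmetrizable_nahm_iff[OF R] by (simp add: defs)
  ultimately show ?thesis
    unfolding nahm_selection_def defs[symmetric] M_def[symmetric] using h A by blast
qed

lemma quadratic_exponent_nahm_matrix:
  "quadratic_exponent (quadratic_matrix (coef_m R) (nahm_matrix R)) =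
     (\<lambda>r s. - of_int (exp_p R) / of_int (exp_h R) / 2 * r^2
            + of_int (coef_m R) / of_int (exp_h R) * r * s
            + of_int (coef_m R) * of_int (exp_v R) / of_int (exp_h R) / 2 * s^2)"
  by (intro ext, subst quadratic_exponent_eq) (simp_all add: quadratic_matrix_eq nahm_matrix_def)

text \<open>With \<open>L(1) = \<pi>\<^sup>2/6\<close>, the action is \<open>L(1) (1 + 1/m) - (m L(x) + L(y)) / m\<close>.\<close>

lemma radial_action_record:
  assumes "is_record R"
  shows "6 * radial_action (ordered_args R) (coef_m R) / pi^2 =
           1 + (1 - 6 * of_rat (const_c0 R)) / of_int (coef_m R)"
proof -
  define m where "m = (of_int (coef_m R) :: real)"
  have m: "m > 1" and L: "rogers_L (arg_y R) =
      of_rat (const_c0 R) * pi^2 - m * rogers_L (arg_x R)"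
    using assms by (auto simp: is_record_def Let_def m_def algebra_simps)
  have "radial_action (ordered_args R) (coef_m R)
      = pi^2 / 6 * (1 + (1 - 6 * of_rat (const_c0 R)) / m)"
    using m by (simp add: radial_action_def ordered_args_def L rogers_L_def[of 1] flip: m_def)
      (simp add: field_simps)
  then show ?thesis by (simp only: m_def) simp
qed

section \<open>The ten records and their reflections\<close>

lemma ten_rows_selected:
  assumes "record_data R \<in> set ten_record_data" "coef_m R > 2" "exp_h R > 0" "exp_p R < 0"
    "exp_u R < 0" "exp_h R dvd exp_p R"
  shows "record_data R \<in> {(3, 4/9, -2, 1, -1, 2), (13, 5/3, -4, 1, -3, 4), (31, 4, -6, 1, -5, 6)}"
  using assms by (auto simp: record_data_def ten_record_data_def)

lemma ten_rows_reflect_not_selected: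
  assumes "record_data R \<in> set ten_record_data"
  shows "\<not> (coef_m R > 2 \<and> exp_h (reflect R) > 0 \<and> exp_p (reflect R) < 0 \<and>
            exp_u (reflect R) < 0)"
  using assms by (auto simp: record_data_def ten_record_data_def reflect_def)

theorem theorem5p1:
  fixes recs :: "rogers_record list"
  assumes "map record_data recs = ten_record_data"
    and "\<forall>R\<in>set recs. is_record R"
  shows "{(coef_m R, A, quadratic_exponent (quadratic_matrix (coef_m R) A),
           6 * radial_action (ordered_args R) (coef_m R) / pi^2) | R A.
            R \<in> set recs \<union> reflect ` set recs \<and>
            coef_m R > 2 \<and>
            symmetrizable_nahm (ordered_args R) (coef_m R) A \<and>
            cross_term (quadratic_matrix (coef_m R) A) > 0 \<and>
            positive_definite (quadratic_matrix (coef_m R) A) \<and>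
            integral_up_to_linear (quadratic_exponent (quadratic_matrix (coef_m R) A))}
       = {(3, vector [vector [2, 1], vector [3, 2]],
             \<lambda>r s. r^2 + 3 * r * s + 3 * s^2, 4/9),
          (13, vector [vector [4, 1], vector [13, 4]],
             \<lambda>r s. 2 * r^2 + 13 * r * s + 26 * s^2, 4/13),
          (31, vector [vector [6, 1], vector [31, 6]],
             \<lambda>r s. 3 * r^2 + 31 * r * s + 93 * s^2, 8/31)}"
    (is "?S = ?T")
proof -
  define out where "out R A = (coef_m R, A, quadratic_exponent (quadratic_matrix (coef_m R) A),
      6 * radial_action (ordered_args R) (coef_m R) / pi^2)" for R A
  define selected :: "(int \<times> rat \<times> int \<times> int \<times> int \<times> int) set" where
    "selected = {(3, 4/9, -2, 1, -1, 2), (13, 5/3, -4, 1, -3, 4), (31, 4, -6, 1, -5, 6)}"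
  have S: "?S = {out R A | R A. R \<in> set recs \<union> reflect ` set recs \<and> nahm_selection R A}"
    unfolding out_def nahm_selection_def ..
  have data: "record_data ` set recs = set ten_record_data"
    using assms(1) by (metis set_map)
  have rel: "exponent_relations R" if "R \<in> set recs" for R
    using assms(2) that is_record_exponent_relations by blast
  have selected_iff: "nahm_selection R A \<longleftrightarrow> record_data R \<in> selected \<and> A = nahm_matrix R"
    if R: "R \<in> set recs" for R A
  proof
    assume "nahm_selection R A"
    then show "record_data R \<in> selected \<and> A = nahm_matrix R"
      using data R ten_rows_selected[of R] nahm_selection_iff[OF rel[OF R]]
      unfolding selected_def by blast
  next
    assume "record_data R \<in> selected \<and> A = nahm_matrix R"
    then show "nahm_selection R A"
      unfolding nahm_selection_iff[OF rel[OF R]] by (auto simp: selected_def record_data_def)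
  qed
  have no_reflection: "\<not> nahm_selection (reflect R) A" if R: "R \<in> set recs" for R A
  proof -
    have "record_data R \<in> set ten_record_data"
      using data R by blast
    moreover have "coef_m (reflect R) = coef_m R"
      by (simp add: reflect_def)
    ultimately show ?thesis
      using ten_rows_reflect_not_selected[of R]
        nahm_selection_iff[OF exponent_relations_reflect[OF rel[OF R]]] by auto
  qed
  \<comment> \<open>The output of a row depends on its data alone.\<close>
  define value_of :: "int \<times> rat \<times> int \<times> int \<times> int \<times> int \<Rightarrow>
      int \<times> (real^2^2) \<times> (real \<Rightarrow> real \<Rightarrow> real) \<times> real" where
    "value_of = (\<lambda>(m, c, p, h, u, v).
       (m, vector [vector [- of_int p / of_int h, 1 / of_int h],
                   vector [of_int m / of_int h, of_int v / of_int h]],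
        \<lambda>r s. - of_int p / of_int h / 2 * r^2 + of_int m / of_int h * r * s
              + of_int m * of_int v / of_int h / 2 * s^2,
        1 + (1 - 6 * of_rat c) / of_int m))"
  have out_eq: "out R (nahm_matrix R) = value_of (record_data R)" if "R \<in> set recs" for R
    using assms(2) that
    by (simp add: out_def value_of_def record_data_def quadratic_exponent_nahm_matrix
        radial_action_record) (simp add: nahm_matrix_def)
  have candidates: "R \<in> set recs \<union> reflect ` set recs \<and> nahm_selection R A \<longleftrightarrow>
      R \<in> set recs \<and> record_data R \<in> selected \<and> A = nahm_matrix R" for R A
    using selected_iff[of R A] no_reflection by auto
  have "?S = {out R (nahm_matrix R) | R. R \<in> set recs \<and> record_data R \<in> selected}"
    unfolding S candidates by blast
  also have "\<dots> = value_of ` (record_data ` set recs \<inter> selected)"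
    using out_eq by (auto simp: image_iff) metis+
  also have "record_data ` set recs \<inter> selected = selected"
    unfolding data by (auto simp: selected_def ten_record_data_def)
  also have "value_of ` selected = ?T"
    by (simp add: selected_def value_of_def of_rat_divide add.commute add.left_commute)
  finally show ?thesis .
qed

end
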